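(* Let $B$ be a $d$-matrix on $[k_1]\times\cdots\times[k_d]$. Then $$f(B,d,n)=\Omega\left(n^{\,d-\frac{k_1+\cdots+k_d-d}{w(B)-1}}\right).$$
   Context: Write $[n]=\{1,\dots,n\}$. For an integer $d\ge 2$, a $d$-matrix is an array with entries in $\{0,1\}$ indexed by $[n_1]\times\cdots\times[n_d]$; it has side length $n$ if it is indexed by $[n]^d$. $w(B)$ is the number of $1$-entries of $B$. A $d$-matrix $A$ represents a $d$-matrix $B$ of the same dimensions if $B$ can be obtained from $A$ by changing some (possibly no) $1$-entries of $A$ to $0$. $A$ contains $B$ if some submatrix of $A$ (obtained by choosing, in each coordinate, a subset of the indices, keeping their order) represents $B$; otherwise $A$ avoids $B$. $f(B,d,n)$ is the maximum possible number of $1$-entries in a $d$-matrix of side length $n$ that avoids $B$. The asymptotic notation is in $n$, with $B$ (and $d$) fixed. *)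

theory Defs
  imports Complex_Main "HOL-Library.FuncSet" "HOL-Library.Landau_Symbols"
begin

text \<open>
  A tuple of dimensions \<open>(n\<^sub>1, \<dots>, n\<^sub>d)\<close> is a function \<open>n\<close> of which only the values on
  \<open>{1..d}\<close> matter.  Index tuples and matrices are extensional functions, so that equality
  of functions is equality of tuples and of matrices.
\<close>

definition indices :: "nat \<Rightarrow> (nat \<Rightarrow> nat) \<Rightarrow> (nat \<Rightarrow> nat) set" where
  "indices d n = (\<Pi>\<^sub>E i\<in>{1..d}. {1..n i})"

definition dmatrix :: "nat \<Rightarrow> (nat \<Rightarrow> nat) \<Rightarrow> ((nat \<Rightarrow> nat) \<Rightarrow> nat) set" where
  "dmatrix d n = (indices d n \<rightarrow>\<^sub>E {0, 1})"

definition ones :: "nat \<Rightarrow> (nat \<Rightarrow> nat) \<Rightarrow> ((nat \<Rightarrow> nat) \<Rightarrow> nat) \<Rightarrow> (nat \<Rightarrow> nat) set" where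
  "ones d n A = {x \<in> indices d n. A x = 1}"

definition weight :: "nat \<Rightarrow> (nat \<Rightarrow> nat) \<Rightarrow> ((nat \<Rightarrow> nat) \<Rightarrow> nat) \<Rightarrow> nat" where
  "weight d n A = card (ones d n A)"

definition represents ::
  "nat \<Rightarrow> (nat \<Rightarrow> nat) \<Rightarrow> ((nat \<Rightarrow> nat) \<Rightarrow> nat) \<Rightarrow> ((nat \<Rightarrow> nat) \<Rightarrow> nat) \<Rightarrow> bool" where
  "represents d n A B \<longleftrightarrow>
     (\<exists>T \<subseteq> ones d n A. B = (\<lambda>x. if x \<in> T then 0 else A x))"

text \<open>
  The submatrix keeping the index set \<open>S i\<close> in coordinate \<open>i\<close>; its \<open>j\<close>-th index in that
  coordinate (counted from 1, whereas list positions start at 0) is the \<open>j\<close>-th smallest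
  element of \<open>S i\<close>.
\<close>

definition submatrix ::
  "nat \<Rightarrow> (nat \<Rightarrow> nat set) \<Rightarrow> ((nat \<Rightarrow> nat) \<Rightarrow> nat) \<Rightarrow> (nat \<Rightarrow> nat) \<Rightarrow> nat" where
  "submatrix d S A =
     (\<lambda>x \<in> indices d (\<lambda>i. card (S i)).
        A (\<lambda>i\<in>{1..d}. sorted_list_of_set (S i) ! (x i - 1)))"

definition contains ::
  "nat \<Rightarrow> (nat \<Rightarrow> nat) \<Rightarrow> ((nat \<Rightarrow> nat) \<Rightarrow> nat) \<Rightarrow> (nat \<Rightarrow> nat) \<Rightarrow> ((nat \<Rightarrow> nat) \<Rightarrow> nat) \<Rightarrow> bool" where
  "contains d n A k B \<longleftrightarrow>
     (\<exists>S. (\<forall>i\<in>{1..d}. S i \<subseteq> {1..n i} \<and> card (S i) = k i) \<and>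
          represents d k (submatrix d S A) B)"

abbreviation avoids ::
  "nat \<Rightarrow> (nat \<Rightarrow> nat) \<Rightarrow> ((nat \<Rightarrow> nat) \<Rightarrow> nat) \<Rightarrow> (nat \<Rightarrow> nat) \<Rightarrow> ((nat \<Rightarrow> nat) \<Rightarrow> nat) \<Rightarrow> bool" where
  "avoids d n A k B \<equiv> \<not> contains d n A k B"

text \<open>
  \<open>extremal k B d n\<close> is \<open>f(B, d, n)\<close> for \<open>B\<close> of dimensions \<open>k\<close>.  The set below is finite; it
  is nonempty whenever \<open>B\<close> has a 1-entry, since then the zero matrix avoids \<open>B\<close>.
\<close>

definition extremal :: "(nat \<Rightarrow> nat) \<Rightarrow> ((nat \<Rightarrow> nat) \<Rightarrow> nat) \<Rightarrow> nat \<Rightarrow> nat \<Rightarrow> nat" where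
  "extremal k B d n =
     Max {weight d (\<lambda>_. n) A | A. A \<in> dmatrix d (\<lambda>_. n) \<and> avoids d (\<lambda>_. n) A k B}"

end

theory Submission
  imports Defs
begin

text \<open>
  Deletion method: pick every cell of the \<open>n\<close>-cube independently with probability
  \<open>p = n powr (-a) / 2\<close>, where \<open>a = (k\<^sub>1 + \<dots> + k\<^sub>d - d) / (w(B) - 1)\<close>.  The expected number of
  cells picked is \<open>p n\<^sup>d\<close>, the expected number of copies of \<open>B\<close> among them at most
  \<open>n powr (k\<^sub>1 + \<dots> + k\<^sub>d) * p ^ w(B)\<close>, which is at most half of that.  Deleting one cell from every
  copy leaves a matrix that avoids \<open>B\<close>.
\<close>

section \<open>Random subsets and the deletion method for uniform set systems\<close>

text \<open>The probability that a random subset of \<open>X\<close> of density \<open>p\<close> contains \<open>S\<close>.\<close>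

lemma sum_subset_weights:
  fixes p :: real
  assumes "finite X" "S \<subseteq> X"
  shows "(\<Sum>Y\<in>Pow X. p ^ card Y * (1 - p) ^ card (X - Y) * (if S \<subseteq> Y then 1 else 0)) = p ^ card S"
proof -
  \<comment> \<open>Replacing the factor \<open>1 - p\<close> by \<open>0\<close> on
    \<open>S\<close> kills exactly those terms of the expansion of
    \<open>(\<Prod>x\<in>X. p + ?g x)\<close> whose \<open>Y\<close> misses a point of
    \<open>S\<close>; the factors left outside \<open>S\<close> are
    \<open>p + (1 - p) = 1\<close>.\<close>
  let ?g = "\<lambda>x. if x \<in> S then 0 else 1 - p"
  have g: "(\<Prod>x\<in>X - Y. ?g x) = (1 - p) ^ card (X - Y) * (if S \<subseteq> Y then 1 else 0)" if "Y \<subseteq> X" for Y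
  proof (cases "S \<subseteq> Y")
    case True
    then have "(\<Prod>x\<in>X - Y. ?g x) = (\<Prod>x\<in>X - Y. 1 - p)"
      by (intro prod.cong) auto
    with True show ?thesis by simp
  next
    case False
    then have "\<exists>x\<in>X - Y. ?g x = 0" using assms by auto
    then have "(\<Prod>x\<in>X - Y. ?g x) = 0" using assms by (intro prod_zero) auto
    with False show ?thesis by simp
  qed
  have "(\<Prod>x\<in>X. p + ?g x) = (\<Sum>Y\<in>Pow X. (\<Prod>x\<in>Y. p) * (\<Prod>x\<in>X - Y. ?g x))"
    using assms by (intro prod_add) auto
  also have "\<dots> = (\<Sum>Y\<in>Pow X. p ^ card Y * (1 - p) ^ card (X - Y) * (if S \<subseteq> Y then 1 else 0))"
    by (intro sum.cong) (simp_all add: g)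
  finally have "(\<Sum>Y\<in>Pow X. p ^ card Y * (1 - p) ^ card (X - Y) * (if S \<subseteq> Y then 1 else 0))
      = (\<Prod>x\<in>X. p + ?g x)" by simp
  also have "\<dots> = (\<Prod>x\<in>X. if x \<in> S then p else 1)"
    by (intro prod.cong) auto
  also have "\<dots> = p ^ card S"
    using assms by (simp add: prod.If_cases Int_absorb1 Int_def[symmetric])
  finally show ?thesis .
qed

text \<open>\<open>p * card X - p ^ w * card F\<close> is the expected number of points minus the
  expected number of members of \<open>F\<close> inside a random subset of density \<open>p\<close>.
  Some subset attains this mean, and dropping one point from each member inside it costs at most one
  point per member.\<close>

lemma exists_large_independent_set:
  fixes p :: real
  assumes "finite X" "0 \<le> p" "p \<le> 1" "w > 0"
    and edges: "finite F" "\<And>e. e \<in> F \<Longrightarrow> e \<subseteq> X" "\<And>e. e \<in> F \<Longrightarrow> card e = w"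
  shows "\<exists>Z\<subseteq>X. (\<forall>e\<in>F. \<not> e \<subseteq> Z) \<and> p * card X - p ^ w * card F \<le> card Z"
proof -
  \<comment> \<open>\<open>q Y\<close> is the probability of the outcome \<open>Y\<close>, so
    expectations are finite sums weighted by \<open>q\<close>.\<close>
  define q where "q Y = p ^ card Y * (1 - p) ^ card (X - Y)" for Y
  let ?m = "p * card X - p ^ w * card F"
  let ?h = "\<lambda>Y. real (card Y) - real (card {e \<in> F. e \<subseteq> Y})"
  have q0: "q Y \<ge> 0" for Y using assms by (simp add: q_def)
  have q1: "(\<Sum>Y\<in>Pow X. q Y) = 1"
    using sum_subset_weights[of X "{}" p] \<open>finite X\<close> by (simp add: q_def)
  have cnt: "real (card {e \<in> E. e \<subseteq> Y}) = (\<Sum>e\<in>E. if e \<subseteq> Y then 1 else 0)"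
    if "finite E" for Y :: "'a set" and E
    using that by (simp add: sum.If_cases Int_def)
  have expect: "(\<Sum>Y\<in>Pow X. q Y * card {e \<in> E. e \<subseteq> Y}) = p ^ v * card E"
    if E: "finite E" "\<And>e. e \<in> E \<Longrightarrow> e \<subseteq> X \<and> card e = v" for E v
  proof -
    have "(\<Sum>Y\<in>Pow X. q Y * card {e \<in> E. e \<subseteq> Y})
        = (\<Sum>Y\<in>Pow X. \<Sum>e\<in>E. q Y * (if e \<subseteq> Y then 1 else 0))"
      by (simp only: cnt[OF E(1)] sum_distrib_left)
    also have "\<dots> = (\<Sum>e\<in>E. \<Sum>Y\<in>Pow X. q Y * (if e \<subseteq> Y then 1 else 0))"
      by (rule sum.swap)
    also have "\<dots> = (\<Sum>e\<in>E. p ^ v)"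
      using E(2) \<open>finite X\<close> unfolding q_def
      by (intro sum.cong refl) (subst sum_subset_weights, auto)
    finally show ?thesis by simp
  qed
  \<comment> \<open>Viewing points as singleton edges lets \<open>expect\<close>, with
    \<open>v = 1\<close>, also give the expected size of the random set.\<close>
  have singletons: "card {e \<in> (\<lambda>x. {x}) ` X. e \<subseteq> Y} = card Y" if "Y \<subseteq> X" for Y
  proof -
    have "{e \<in> (\<lambda>x. {x}) ` X. e \<subseteq> Y} = (\<lambda>x. {x}) ` Y" using that by auto
    then show ?thesis by (simp add: card_image)
  qed
  have "(\<Sum>Y\<in>Pow X. q Y * card Y) = (\<Sum>Y\<in>Pow X. q Y * card {e \<in> (\<lambda>x. {x}) ` X. e \<subseteq> Y})"
    by (intro sum.cong) (simp_all add: singletons)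
  also have "\<dots> = p ^ 1 * card ((\<lambda>x. {x}) ` X)"
    using \<open>finite X\<close> by (intro expect) auto
  finally have "(\<Sum>Y\<in>Pow X. q Y * card Y) = p * card X"
    by (simp add: card_image)
  then have mean: "(\<Sum>Y\<in>Pow X. q Y * ?h Y) = ?m"
    using expect[of F w] edges by (simp add: right_diff_distrib sum_subtractf)
  have "\<exists>Y\<in>Pow X. ?m \<le> ?h Y"
  proof (rule ccontr)
    assume "\<not> ?thesis"
    then have less: "?h Y < ?m" if "Y \<in> Pow X" for Y using that not_le by blast
    \<comment> \<open>For \<open>p = 0\<close> or \<open>p = 1\<close> some weights vanish, so
      strictness needs a \<open>Y\<close> of positive weight.\<close>
    obtain Y where "Y \<in> Pow X" "q Y \<noteq> 0"
      by (rule sum.not_neutral_contains_not_neutral[of q "Pow X"]) (use q1 in auto)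
    then have Y: "Y \<in> Pow X" "q Y > 0" using q0[of Y] by simp_all
    have "(\<Sum>Y\<in>Pow X. q Y * ?h Y) < (\<Sum>Y\<in>Pow X. q Y * ?m)"
    proof (rule sum_strict_mono_ex1)
      show "\<forall>Y\<in>Pow X. q Y * ?h Y \<le> q Y * ?m"
        using less q0 by (auto intro!: mult_left_mono intro: less_imp_le)
      show "\<exists>Y\<in>Pow X. q Y * ?h Y < q Y * ?m"
        using Y less by (intro bexI[of _ Y] mult_strict_left_mono)
    qed (use \<open>finite X\<close> in simp)
    also have "\<dots> = ?m" using q1 by (simp flip: sum_distrib_right)
    finally show False using mean by simp
  qed
  then obtain Y where Y: "Y \<subseteq> X" "?m \<le> ?h Y" by auto
  define G where "G = {e \<in> F. e \<subseteq> Y}"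
  \<comment> \<open>\<open>w > 0\<close> makes every edge nonempty; \<open>c e\<close> is the point
    deleted from \<open>e\<close>.\<close>
  have "\<exists>x. x \<in> e" if "e \<in> F" for e
    using edges(3)[OF that] \<open>w > 0\<close> by (cases "e = {}") auto
  then obtain c where c: "\<And>e. e \<in> F \<Longrightarrow> c e \<in> e" by metis
  have "finite G" "finite Y" using edges(1) Y(1) \<open>finite X\<close> by (auto simp: G_def intro: finite_subset)
  have "card Y \<le> card (Y - c ` G) + card (c ` G)"
    using \<open>finite G\<close> diff_card_le_card_Diff[of "c ` G" Y] by simp
  also have "card (c ` G) \<le> card G" using \<open>finite G\<close> by (rule card_image_le)
  finally have "?m \<le> card (Y - c ` G)" using Y(2) by (simp add: G_def)
  moreover have "\<not> e \<subseteq> Y - c ` G" if "e \<in> F" for e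
    using c[OF that] that by (auto simp: G_def)
  ultimately show ?thesis using Y(1) by (intro exI[of _ "Y - c ` G"]) auto
qed

section \<open>Copies of \<open>B\<close> as sets of cells\<close>

text \<open>This is the index map inside \<open>submatrix\<close>; naming it makes a copy of
  \<open>B\<close> the image of \<open>ones d k B\<close>.\<close>

definition position :: "nat \<Rightarrow> (nat \<Rightarrow> nat set) \<Rightarrow> (nat \<Rightarrow> nat) \<Rightarrow> (nat \<Rightarrow> nat)" where
  "position d S x = (\<lambda>i\<in>{1..d}. sorted_list_of_set (S i) ! (x i - 1))"

lemma finite_indices: "finite (indices d n)"
  by (simp add: indices_def finite_PiE)

lemma finite_dmatrix: "finite (dmatrix d n)"
  by (simp add: dmatrix_def finite_PiE finite_indices)

lemma indices_cong: "(\<And>i. i \<in> {1..d} \<Longrightarrow> k i = m i) \<Longrightarrow> indices d k = indices d m"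
  unfolding indices_def by (intro PiE_cong) simp

lemma position_in_indices:
  assumes S: "\<And>i. i \<in> {1..d} \<Longrightarrow> S i \<subseteq> {1..n i} \<and> card (S i) = k i" and x: "x \<in> indices d k"
  shows "position d S x \<in> indices d n"
proof -
  have "sorted_list_of_set (S i) ! (x i - 1) \<in> {1..n i}" if i: "i \<in> {1..d}" for i
  proof -
    have "finite (S i)" using S[OF i] by (auto intro: finite_subset)
    moreover have "x i \<in> {1..k i}" using x i by (auto simp: indices_def PiE_iff)
    ultimately have "sorted_list_of_set (S i) ! (x i - 1) \<in> S i"
      using S[OF i] nth_mem[of "x i - 1" "sorted_list_of_set (S i)"] by auto
    then show ?thesis using S[OF i] by auto
  qed
  then show ?thesis by (auto simp: indices_def position_def)
qed

text \<open>Sorted lists of sets have no repetitions. Hence a copy of \<open>B\<close> has exactly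
  \<open>weight d k B\<close> cells, which gives the uniformity that the deletion lemma asks
  for.\<close>

lemma inj_on_position:
  assumes S: "\<And>i. i \<in> {1..d} \<Longrightarrow> card (S i) = k i"
  shows "inj_on (position d S) (indices d k)"
proof (rule inj_onI)
  fix x y assume x: "x \<in> indices d k" and y: "y \<in> indices d k"
    and eq: "position d S x = position d S y"
  have "x i = y i" if i: "i \<in> {1..d}" for i
  proof -
    have xi: "x i \<in> {1..k i}" and yi: "y i \<in> {1..k i}"
      using x y i by (auto simp: indices_def PiE_iff)
    have "sorted_list_of_set (S i) ! (x i - 1) = sorted_list_of_set (S i) ! (y i - 1)"
      using fun_cong[OF eq, of i] i by (simp add: position_def)
    then have "x i - 1 = y i - 1"
      using S[OF i] xi yi by (subst (asm) nth_eq_iff_index_eq) auto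
    \<comment> \<open>Indices start at 1, so the truncated subtraction loses nothing.\<close>
    then show ?thesis using xi yi by auto
  qed
  then show "x = y"
    using x y unfolding indices_def by (rule_tac PiE_ext) auto
qed

text \<open>Representing only turns 1-entries into 0, so every 1-entry of \<open>B\<close> sits on a
  1-entry of the submatrix.\<close>

lemma contains_imp_positions:
  assumes "contains d n A k B"
  obtains S where "S \<in> (\<Pi>\<^sub>E i\<in>{1..d}. {T. T \<subseteq> {1..n i} \<and> card T = k i})"
    and "position d S ` ones d k B \<subseteq> ones d n A"
proof -
  obtain S where S: "\<And>i. i \<in> {1..d} \<Longrightarrow> S i \<subseteq> {1..n i} \<and> card (S i) = k i"
    and rep: "represents d k (submatrix d S A) B"
    using assms unfolding contains_def by blast
  have "A (position d S x) = 1" if x: "x \<in> ones d k B" for x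
  proof -
    have "submatrix d S A x = 1"
      using rep x by (auto simp: represents_def ones_def split: if_splits)
    moreover have "x \<in> indices d (\<lambda>i. card (S i))"
      using x S indices_cong[of d "\<lambda>i. card (S i)" k] by (auto simp: ones_def)
    ultimately show ?thesis by (simp add: submatrix_def position_def)
  qed
  moreover have "position d S x \<in> indices d n" if "x \<in> ones d k B" for x
    using S that by (intro position_in_indices) (auto simp: ones_def)
  \<comment> \<open>Restricting \<open>S\<close> to \<open>{1..d}\<close> makes it extensional, so
    that the possible choices can be counted.\<close>
  moreover have "position d (restrict S {1..d}) = position d S"
    by (auto simp: position_def fun_eq_iff)
  ultimately have "position d (restrict S {1..d}) ` ones d k B \<subseteq> ones d n A"
    by (auto simp: ones_def)
  moreover have "restrict S {1..d} \<in> (\<Pi>\<^sub>E i\<in>{1..d}. {T. T \<subseteq> {1..n i} \<and> card T = k i})"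
    using S by auto
  ultimately show ?thesis using that by blast
qed

section \<open>Lower bounds for the extremal function\<close>

lemma weight_le_extremal:
  assumes "A \<in> dmatrix d (\<lambda>_. n)" "avoids d (\<lambda>_. n) A k B"
  shows "weight d (\<lambda>_. n) A \<le> extremal k B d n"
  unfolding extremal_def using assms finite_dmatrix[of d "\<lambda>_. n"]
  by (intro Max_ge) auto

text \<open>The deletion lemma applies to the cells of the cube, with the potential copies of
  \<open>B\<close> as edges. There are at most \<open>n ^ (\<Sum>i=1..d. k i)\<close> of them, since
  \<open>n choose r\<close> is at most \<open>n ^ r\<close>.\<close>

lemma extremal_ge:
  fixes p :: real
  assumes "0 \<le> p" "p \<le> 1" "weight d k B > 0"
  shows "p * real n ^ d - p ^ weight d k B * real n ^ (\<Sum>i=1..d. k i) \<le> extremal k B d n"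
proof -
  define C where "C = (\<Pi>\<^sub>E i\<in>{1..d}. {T. T \<subseteq> {1..n} \<and> card T = k i})"
  define F where "F = (\<lambda>S. position d S ` ones d k B) ` C"
  let ?X = "indices d (\<lambda>_. n)"
  have finC: "finite C" unfolding C_def by (intro finite_PiE) auto
  have "(n choose r) \<le> n ^ r" for r
    by (cases "r \<le> n") (simp_all add: binomial_le_pow binomial_eq_0)
  then have "card C \<le> n ^ (\<Sum>i=1..d. k i)"
    by (auto simp: C_def card_PiE n_subsets power_sum intro!: prod_mono)
  moreover have "card F \<le> card C" using finC by (simp add: F_def card_image_le)
  ultimately have "card F \<le> n ^ (\<Sum>i=1..d. k i)" by simp
  then have cardF: "real (card F) \<le> real n ^ (\<Sum>i=1..d. k i)"
    by (metis of_nat_le_iff of_nat_power)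
  have S: "S i \<subseteq> {1..n}" "card (S i) = k i" if "S \<in> C" "i \<in> {1..d}" for S i
    using that by (auto simp: C_def PiE_iff)
  have "\<exists>Z\<subseteq>?X. (\<forall>e\<in>F. \<not> e \<subseteq> Z) \<and>
      p * card ?X - p ^ weight d k B * card F \<le> card Z"
  proof (rule exists_large_independent_set)
    show "finite F" using finC by (simp add: F_def)
    fix e assume "e \<in> F"
    then obtain S where SC: "S \<in> C" and e: "e = position d S ` ones d k B" by (auto simp: F_def)
    have "position d S x \<in> ?X" if "x \<in> ones d k B" for x
      using S[OF SC] that by (intro position_in_indices[of d S _ k]) (simp_all add: ones_def)
    then show "e \<subseteq> ?X" unfolding e by blast
    have "inj_on (position d S) (ones d k B)"
      using inj_on_position[of d S k] S[OF SC] by (auto intro: inj_on_subset simp: ones_def)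
    then show "card e = weight d k B" by (simp add: e card_image weight_def)
  qed (use assms finite_indices in auto)
  then obtain Z where Z: "Z \<subseteq> ?X" "\<And>e. e \<in> F \<Longrightarrow> \<not> e \<subseteq> Z"
    and cardZ: "p * card ?X - p ^ weight d k B * card F \<le> card Z" by auto
  define A where "A = (\<lambda>x\<in>?X. if x \<in> Z then 1 else 0 :: nat)"
  have ones: "ones d (\<lambda>_. n) A = Z" using Z(1) by (auto simp: ones_def A_def)
  have "avoids d (\<lambda>_. n) A k B"
  proof
    assume "contains d (\<lambda>_. n) A k B"
    then obtain S where "S \<in> C" "position d S ` ones d k B \<subseteq> Z"
      unfolding C_def ones[symmetric] by (rule contains_imp_positions)
    then show False using Z(2) by (auto simp: F_def)
  qed
  moreover have "A \<in> dmatrix d (\<lambda>_. n)" by (auto simp: A_def dmatrix_def)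
  ultimately have "card Z \<le> extremal k B d n"
    using weight_le_extremal[of A d n k B] by (simp add: weight_def ones)
  moreover have "card ?X = n ^ d" by (simp add: indices_def card_PiE)
  moreover have "p ^ weight d k B * card F \<le> p ^ weight d k B * real n ^ (\<Sum>i=1..d. k i)"
    using cardF assms by (intro mult_left_mono) auto
  ultimately show ?thesis using cardZ by simp
qed

theorem lemma4p1:
  fixes d :: nat and k :: "nat \<Rightarrow> nat" and B :: "(nat \<Rightarrow> nat) \<Rightarrow> nat"
  assumes "d \<ge> 2"
    and "B \<in> dmatrix d k"
    and "weight d k B \<ge> 2"
  shows "(\<lambda>n. real (extremal k B d n)) \<in>
    \<Omega>(\<lambda>n. real n powr (real d - ((\<Sum>i=1..d. real (k i)) - real d) / (real (weight d k B) - 1)))"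
proof -
  define w where "w = weight d k B"
  define K where "K = (\<Sum>i=1..d. k i)"
  define a where "a = (real K - real d) / (real w - 1)"
  have "ones d k B \<noteq> {}" using assms(3) by (auto simp: weight_def)
  then obtain x where "x \<in> indices d k" by (auto simp: ones_def)
  \<comment> \<open>A 1-entry of \<open>B\<close> rules out zero dimensions, so
    \<open>d \<le> K\<close> and \<open>a \<ge> 0\<close>, which later keeps \<open>p\<close> below
    1.\<close>
  then have "1 \<le> k i" if "i \<in> {1..d}" for i
    using PiE_mem[OF \<open>x \<in> indices d k\<close>[unfolded indices_def] that] by simp
  then have "(\<Sum>i=1..d. 1) \<le> K" unfolding K_def by (intro sum_mono) auto
  then have "d \<le> K" by simp
  have "w \<ge> 2" using assms(3) by (simp add: w_def)
  have "a \<ge> 0" using \<open>d \<le> K\<close> \<open>w \<ge> 2\<close> by (simp add: a_def)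
  \<comment> \<open>The defining equation of \<open>a\<close>: it balances the powers of
    \<open>n\<close> in \<open>p ^ w * real n ^ K\<close> and \<open>p * real n ^ d\<close>.\<close>
  have exponent: "real K - a * real w = real d - a"
  proof -
    have "a * (real w - 1) = real K - real d" using \<open>w \<ge> 2\<close> by (simp add: a_def)
    then show ?thesis by (simp add: algebra_simps)
  qed
  have "real n powr (real d - a) / 4 \<le> extremal k B d n" if "n \<ge> 1" for n
  proof -
    \<comment> \<open>With the factor 1/2 the main term has coefficient 1/2, and the loss at most
      1/4 because \<open>w \<ge> 2\<close>; so 1/4 survives.\<close>
    define p where "p = real n powr (-a) / 2"
    have n: "real n > 0" using that by simp
    have "real n powr (-a) \<le> 1" using powr_mono[of "-a" 0 "real n"] that \<open>a \<ge> 0\<close> by simp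
    then have p: "0 \<le> p" "p \<le> 1" by (auto simp: p_def)
    have "p * real n ^ d = real n powr (real d - a) / 2"
      using n by (simp add: p_def powr_diff powr_minus_divide powr_realpow)
    moreover have "p ^ w * real n ^ K \<le> real n powr (real d - a) / 4"
    proof -
      have "p ^ w * real n ^ K = (1 / 2) ^ w * (real n powr (- (a * w)) * real n powr K)"
        using n by (simp add: p_def power_divide powr_power powr_realpow mult.commute)
      also have "\<dots> = (1 / 2) ^ w * real n powr (real d - a)"
        using exponent by (simp flip: powr_add)
      also have "\<dots> \<le> (1 / 2) ^ 2 * real n powr (real d - a)"
        using \<open>w \<ge> 2\<close> by (intro mult_right_mono power_decreasing) auto
      finally show ?thesis by (simp add: power2_eq_square)
    qed
    moreover have "p * real n ^ d - p ^ w * real n ^ K \<le> extremal k B d n"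
      using extremal_ge[OF p, of d k B n] \<open>w \<ge> 2\<close> by (simp add: w_def K_def)
    ultimately show ?thesis by simp
  qed
  then have "(\<lambda>n. real (extremal k B d n)) \<in> \<Omega>(\<lambda>n. real n powr (real d - a))"
    by (intro landau_omega.bigI[of "1/4"]) (auto intro!: eventually_sequentiallyI[of 1])
  then show ?thesis by (simp add: a_def K_def w_def)
qed

end
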